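(* Let $a,b,c,z\in\mathbb{C}$ with $-c\notin\mathbb{N}\cup\{0\}$. Then $$F^3(a,b;c;z)=\sum_{n=0}^\infty v_n z^n,\qquad |z|<1,$$ with $v_0=1$, $v_1=3ab/c$, $v_2=\frac{3a^2b^2}{c^2}+\frac{3a(a+1)(b+1)b}{2c(c+1)}$ and (with $v_{-1}=0$) $$v_{n+1}=\beta_0(n)v_n+\beta_1(n)v_{n-1}+\beta_2(n)v_{n-2},\qquad n\ge 1,$$ where, writing $D(n)=(n+1)(c+n)(2c+n-1)(3c+n-2)$, $$\begin{aligned} \beta_0(n)=\frac{1}{D(n)}\Big[&3n^4+6(a+b+2c-2)n^3+\big(2a(5b+11c-9)+11c(2b+c)-18b-26c+15\big)n^2\\ &+\big(c^2(18a+18b-7)+c(a(30b-29)-29b+13)+4a(3-5b)+12b-6\big)n\\ &+3ab(c(6c-7)+2)\Big], \end{aligned}$$ $$\begin{aligned} \beta_1(n)=-\frac{1}{D(n)}\Big[&3n^4+6(2a+2b+c-3)n^3\\ &+\big(11a^2+42ab+22ac-54a+11b^2+22bc-54b-22c+40\big)n^2\\ &+3\big(10a^2b+6a^2c-11a^2+10ab^2+22abc-42ab-17ac+26a\big)n\\ &+3\big(6b^2c-11b^2-17bc+26b+9c-13\big)n\\ &+9a^2b^2+36a^2bc-45a^2b-18a^2c+22a^2+36ab^2c-45ab^2-72abc\\ &+87ab+29ac-36a-18b^2c+22b^2+29bc-36b-11c+14\Big], \end{aligned}$$ $$\beta_2(n)=\frac{(3a+n-2)(3b+n-2)(2a+b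+n-2)(a+2b+n-2)}{D(n)}.$$
   Context: $F(a,b;c;z)=\sum_{k=0}^\infty \frac{(a)_k(b)_k}{(c)_k\,k!}z^k$ for $|z|<1$, $-c\notin\mathbb{N}\cup\{0\}$, is the Gaussian hypergeometric function, where $(x)_k=x(x+1)\cdots(x+k-1)$, $(x)_0=1$. $F^3(a,b;c;z)$ means $(F(a,b;c;z))^3$.
   Formalization: The recurrence is asserted only at those n ≥ 1 with D(n) ≠ 0, since the hypothesis on c allows D(n) = 0 (e.g. c = 1/3, n = 1 or c = −1/2, n = 2), where the β_i(n) are undefined. *)

theory Defs
  imports "HOL-Analysis.Analysis"
begin

text \<open>
  The series converges only for \<open>norm z < 1\<close> (or when it terminates) and needs \<open>- c \<notin> \<nat>\<close>; outside this
  range the value is a junk value of \<^const>\<open>suminf\<close> or of division by zero.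
\<close>

definition hyp2F1 :: "complex \<Rightarrow> complex \<Rightarrow> complex \<Rightarrow> complex \<Rightarrow> complex" where
  "hyp2F1 a b c z =
     (\<Sum>k. pochhammer a k * pochhammer b k / (pochhammer c k * fact k) * z ^ k)"

lemma hyp2F1_eq_eval_fps: "hyp2F1 a b c z = eval_fps (fps_hypergeo [a, b] [c] 1) z"
  by (simp add: hyp2F1_def eval_fps_def)

definition D_cube :: "complex \<Rightarrow> complex \<Rightarrow> complex" where
  "D_cube c n = (n + 1) * (c + n) * (2*c + n - 1) * (3*c + n - 2)"

definition beta0 :: "complex \<Rightarrow> complex \<Rightarrow> complex \<Rightarrow> complex \<Rightarrow> complex" where
  "beta0 a b c n = 1 / D_cube c n *
     (3*n^4 + 6*(a + b + 2*c - 2)*n^3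
      + (2*a*(5*b + 11*c - 9) + 11*c*(2*b + c) - 18*b - 26*c + 15)*n^2
      + (c^2*(18*a + 18*b - 7) + c*(a*(30*b - 29) - 29*b + 13) + 4*a*(3 - 5*b) + 12*b - 6)*n
      + 3*a*b*(c*(6*c - 7) + 2))"

definition beta1 :: "complex \<Rightarrow> complex \<Rightarrow> complex \<Rightarrow> complex \<Rightarrow> complex" where
  "beta1 a b c n = - (1 / D_cube c n) *
     (3*n^4 + 6*(2*a + 2*b + c - 3)*n^3
      + (11*a^2 + 42*a*b + 22*a*c - 54*a + 11*b^2 + 22*b*c - 54*b - 22*c + 40)*n^2
      + 3*(10*a^2*b + 6*a^2*c - 11*a^2 + 10*a*b^2 + 22*a*b*c - 42*a*b - 17*a*c + 26*a)*n
      + 3*(6*b^2*c - 11*b^2 - 17*b*c + 26*b + 9*c - 13)*n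
      + 9*a^2*b^2 + 36*a^2*b*c - 45*a^2*b - 18*a^2*c + 22*a^2 + 36*a*b^2*c - 45*a*b^2 - 72*a*b*c
      + 87*a*b + 29*a*c - 36*a - 18*b^2*c + 22*b^2 + 29*b*c - 36*b - 11*c + 14)"

definition beta2 :: "complex \<Rightarrow> complex \<Rightarrow> complex \<Rightarrow> complex \<Rightarrow> complex" where
  "beta2 a b c n =
     (3*a + n - 2) * (3*b + n - 2) * (2*a + b + n - 2) * (a + 2*b + n - 2) / D_cube c n"

text \<open>
  The assumption \<open>- c \<notin> \<nat>\<close> does not exclude \<open>D_cube c n = 0\<close> for some \<open>n \<ge> 1\<close>: this happens when
  \<open>2 * c = 1 - n\<close> or \<open>3 * c = 2 - n\<close>, e.g. for \<open>c = -1/2\<close>, \<open>n = 2\<close> and for \<open>c = 1/3\<close>, \<open>n = 1\<close>. There the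
  coefficients \<open>\<beta>\<^sub>i(n)\<close> are undefined, so the recurrence is only asserted at those \<open>n\<close> where
  \<open>D_cube c n \<noteq> 0\<close>. The conditional expression encodes \<open>v\<^sub>-\<^sub>1 = 0\<close>, which is used for \<open>n = 1\<close>.
\<close>

definition cube_recurrence :: "complex \<Rightarrow> complex \<Rightarrow> complex \<Rightarrow> (nat \<Rightarrow> complex) \<Rightarrow> bool" where
  "cube_recurrence a b c v \<longleftrightarrow>
     (\<forall>n\<ge>1. D_cube c (of_nat n) \<noteq> 0 \<longrightarrow>
        v (n + 1) = beta0 a b c (of_nat n) * v n + beta1 a b c (of_nat n) * v (n - 1)
          + beta2 a b c (of_nat n) * (if n \<ge> 2 then v (n - 2) else 0))"

end

theory Submission
  imports Defs
begin

text \<open>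
  Write \<open>\<theta> = X d/dX\<close> on formal power series. The series \<open>F = F(a, b; c; X)\<close> satisfies the second-order
  equation \<open>(1 - X) \<theta>\<^sup>2F = (s X - e) \<theta>F + q X F\<close> with \<open>s = a + b\<close>, \<open>q = a b\<close>, \<open>e = c - 1\<close>, which is
  just the two-term recurrence of its coefficients. Consequently \<open>(1 - X) \<theta>\<close> sends each of the
  four products \<open>F\<^sup>3, F\<^sup>2 \<theta>F, F (\<theta>F)\<^sup>2, (\<theta>F)\<^sup>3\<close> to a combination of itself and its neighbours, with
  polynomial coefficients: on these products it acts by a tridiagonal matrix. Starting from \<open>F\<^sup>3\<close>,
  each product is therefore obtained, up to a power of \<open>1 - X\<close>, from
  its predecessors by one more application of \<open>\<theta>\<close>, and the last row of the matrix becomes a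
  fourth-order linear equation for \<open>F\<^sup>3\<close>: the symmetric cube of the hypergeometric equation
  (\<open>symmetric_cube_equation\<close>).

  Expanded, that equation reads \<open>P\<^sub>0(\<theta>) y = X P\<^sub>1(\<theta>) y + X\<^sup>2 P\<^sub>2(\<theta>) y + X\<^sup>3 P\<^sub>3(\<theta>) y\<close> with polynomials
  \<open>P\<^sub>i\<close> of degree four (\<open>hypergeometric_cube_equation\<close>). As \<open>\<theta>\<close> multiplies the \<open>n\<close>-th coefficient by
  \<open>n\<close>, comparing coefficients of \<open>X\<^bsup>n+1\<^esup>\<close> gives the four-term recurrence; the leading factor is
  \<open>P\<^sub>0(n + 1) = (n + 1) (n + 1 + e) (n + 1 + 2e) (n + 1 + 3e)\<close>, which is \<open>D(n)\<close>. Analytically, \<open>F\<close>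
  converges in the unit disc by the ratio test, so evaluation there commutes with taking the cube.
\<close>

section \<open>The symmetric cube of a second-order equation\<close>

lemma fps_XD_mult:
  fixes f g :: "'a :: comm_ring_1 fps"
  shows "fps_XD (f * g) = fps_XD f * g + f * fps_XD g"
  by (simp add: fps_XD_def algebra_simps)

lemma fps_XD_diff:
  fixes f g :: "'a :: comm_ring_1 fps"
  shows "fps_XD (f - g) = fps_XD f - fps_XD g"
  by (simp add: fps_XD_def algebra_simps)

lemma fps_XD_const: "fps_XD (fps_const k) = (0 :: 'a :: comm_ring_1 fps)"
  by (simp add: fps_XD_def)

lemma fps_XD_numeral: "fps_XD (numeral k) = (0 :: 'a :: comm_ring_1 fps)"
  unfolding numeral_fps_const by (rule fps_XD_const)

lemma fps_XD_one: "fps_XD 1 = (0 :: 'a :: comm_ring_1 fps)"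
  by (simp add: fps_XD_def)

lemma fps_XD_X: "fps_XD fps_X = (fps_X :: 'a :: comm_ring_1 fps)"
  by (simp add: fps_XD_def)

lemmas fps_XD_rules =
  fps_XD_add fps_XD_mult fps_XD_diff fps_XD_const fps_XD_numeral fps_XD_one fps_XD_X

text \<open>
  With \<open>G = \<theta>F\<close>, the auxiliary series are \<open>l\<^sub>1 = 3 F\<^sup>2 G\<close>, \<open>l\<^sub>2 = 6 w F G\<^sup>2\<close> and \<open>l\<^sub>3 = 6 w\<^sup>2 G\<^sup>3\<close>. The
  factorials and powers of \<open>w\<close> are chosen so that every step of the chain stays in the ring of
  power series, without division by \<open>w\<close>. The chain stops at \<open>l\<^sub>3\<close> because differentiating \<open>G\<^sup>3\<close>
  produces no new product of \<open>F\<close> and \<open>G\<close>.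
\<close>

lemma symmetric_cube_equation:
  fixes F w p r :: "'a :: idom fps"
  assumes ode: "w * fps_XD (fps_XD F) = p * fps_XD F + r * F"
  defines "l1 \<equiv> fps_XD (F ^ 3)"
  defines "l2 \<equiv> w * fps_XD l1 - p * l1 - 3 * r * F ^ 3"
  defines "l3 \<equiv> w * fps_XD l2 - (2 * p + fps_XD w) * l2 - 4 * w * r * l1"
  shows "w * fps_XD l3 = (3 * p + 2 * fps_XD w) * l3 + 3 * w * r * l2"
proof -
  define G where "G = fps_XD F"
  define H where "H = fps_XD G"
  have H: "w * H = p * G + r * F"
    using ode by (simp add: H_def G_def)
  have DF: "fps_XD F = G" and DG: "fps_XD G = H"
    by (simp_all add: G_def H_def)
  have l1: "l1 = 3 * F * F * G"
    unfolding l1_def power3_eq_cube fps_XD_rules DF by algebra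
  have "l2 = w * (6 * F * G * G + 3 * F * F * H) - p * l1 - 3 * r * F ^ 3"
    unfolding l2_def l1 fps_XD_rules DF DG by algebra
  then have l2: "l2 = 6 * w * F * G * G"
    unfolding l1 using H by algebra
  have "l3 = w * (6 * fps_XD w * F * G * G + 6 * w * G * G * G + 12 * w * F * G * H)
      - (2 * p + fps_XD w) * l2 - 4 * w * r * l1"
    unfolding l3_def l2 fps_XD_rules DF DG by algebra
  then have l3: "l3 = 6 * w * w * G * G * G"
    unfolding l1 l2 using H by algebra
  have "w * fps_XD l3 = w * (12 * w * fps_XD w * G * G * G + 18 * w * w * G * G * H)"
    unfolding l3 fps_XD_rules DG by algebra
  then show ?thesis
    unfolding l3 l2 using H by algebra
qed

section \<open>The fourth-order equation of the hypergeometric cube\<close>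

lemma fps_hypergeo_2_1_nth_Suc:
  fixes a b c :: "'a :: field_char_0"
  shows "fps_nth (fps_hypergeo [a, b] [c] 1) (Suc k)
    = (a + of_nat k) * (b + of_nat k) / ((1 + of_nat k) * (c + of_nat k))
        * fps_nth (fps_hypergeo [a, b] [c] 1) k"
  by (subst fps_hypergeo_rec) simp

lemma fps_hypergeo_2_1_equation:
  fixes a b c :: "'a :: field_char_0"
  assumes c: "\<And>k. c + of_nat k \<noteq> 0"
  defines "F \<equiv> fps_hypergeo [a, b] [c] 1"
  shows "(1 - fps_X) * fps_XD (fps_XD F)
    = (fps_const (a + b) * fps_X - fps_const (c - 1)) * fps_XD F + fps_const (a * b) * fps_X * F"
proof (rule fps_ext)
  fix n
  show "fps_nth ((1 - fps_X) * fps_XD (fps_XD F)) n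
    = fps_nth ((fps_const (a + b) * fps_X - fps_const (c - 1)) * fps_XD F
        + fps_const (a * b) * fps_X * F) n"
  proof (cases n)
    case 0
    then show ?thesis by (simp add: algebra_simps)
  next
    case (Suc k)
    have "(1 :: 'a) + of_nat k \<noteq> 0"
      using of_nat_neq_0[of k] by simp
    then have "(1 + of_nat k) * (c + of_nat k) * fps_nth F (Suc k)
        = (a + of_nat k) * (b + of_nat k) * fps_nth F k"
      using c[of k] unfolding F_def fps_hypergeo_2_1_nth_Suc by simp
    then show ?thesis
      by (simp add: Suc ring_distribs mult.assoc) (simp add: algebra_simps)
  qed
qed

text \<open>
  The chain of \<open>symmetric_cube_equation\<close> for \<open>w = 1 - X\<close>, \<open>p = s X - e\<close>, \<open>r = q X\<close>, expanded and
  sorted by powers of \<open>X\<close>.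
\<close>

lemma hypergeometric_cube_equation:
  fixes F :: "'a :: idom fps" and s q e :: 'a
  assumes ode: "(1 - fps_X) * fps_XD (fps_XD F)
    = (fps_const s * fps_X - fps_const e) * fps_XD F + fps_const q * fps_X * F"
  defines "y0 \<equiv> F ^ 3"
  defines "y1 \<equiv> fps_XD y0"
  defines "y2 \<equiv> fps_XD y1"
  defines "y3 \<equiv> fps_XD y2"
  defines "y4 \<equiv> fps_XD y3"
  defines "S \<equiv> fps_const s" and "Q \<equiv> fps_const q" and "E \<equiv> fps_const e"
  shows "y4 + 6 * E * y3 + 11 * E^2 * y2 + 6 * E^3 * y1
    = fps_X * (3 * y4 + (12 * E + 6 * S) * y3
        + (11 * E^2 + 22 * S * E + 10 * Q + 4 * S - 4 * E) * y2
        + (18 * S * E^2 + 30 * Q * E + 7 * S * E - 7 * E^2 + 10 * Q + S - E) * y1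
        + 3 * Q * (6 * E^2 + 5 * E + 1) * y0)
    - fps_X^2 * (3 * y4 + (6 * E + 12 * S) * y3
        + (11 * S^2 + 22 * S * E + 20 * Q + 4 * S - 4 * E) * y2
        + (18 * S^2 * E + 30 * S * Q + 7 * S^2 + 30 * Q * E - 7 * S * E + 10 * Q - S + E) * y1
        + 3 * Q * (12 * S * E + 3 * Q + 7 * S - 2 * E - 1) * y0)
    + fps_X^3 * (y4 + 6 * S * y3 + (11 * S^2 + 10 * Q) * y2 + (6 * S^3 + 30 * S * Q) * y1
        + 9 * Q * (2 * S^2 + Q) * y0)"
    (is "?lhs = ?rhs")
proof -
  define l2 where "l2 = (1 - fps_X) * y2 - (S * fps_X - E) * y1 - 3 * (Q * fps_X) * y0"
  define l3 where "l3 = (1 - fps_X) * fps_XD l2 - (2 * (S * fps_X - E) + fps_XD (1 - fps_X)) * l2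
    - 4 * (1 - fps_X) * (Q * fps_X) * y1"
  have D: "fps_XD S = 0" "fps_XD Q = 0" "fps_XD E = 0" "fps_XD y0 = y1" "fps_XD y1 = y2"
    "fps_XD y2 = y3" "fps_XD y3 = y4"
    by (simp_all add: S_def Q_def E_def y1_def y2_def y3_def y4_def fps_XD_const)
  have top: "(1 - fps_X) * fps_XD l3
      = (3 * (S * fps_X - E) + 2 * fps_XD (1 - fps_X)) * l3 + 3 * (1 - fps_X) * (Q * fps_X) * l2"
    using symmetric_cube_equation[OF ode]
    unfolding l2_def l3_def y2_def y1_def y0_def S_def Q_def E_def .
  have Dl2: "fps_XD l2 = (1 - fps_X) * y3 - fps_X * y2 - (S * fps_X - E) * y2 - S * fps_X * y1
      - 3 * Q * fps_X * y1 - 3 * Q * fps_X * y0"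
    unfolding l2_def fps_XD_rules D by algebra
  have l3: "l3 = (1 - fps_X) * ((1 - fps_X) * y3 - fps_X * y2 - (S * fps_X - E) * y2
        - S * fps_X * y1 - 3 * Q * fps_X * y1 - 3 * Q * fps_X * y0)
      - (2 * (S * fps_X - E) - fps_X) * l2 - 4 * (1 - fps_X) * (Q * fps_X) * y1"
    unfolding l3_def Dl2 fps_XD_rules by simp
  have Dl3: "fps_XD l3
      = (1 - fps_X) * ((1 - fps_X) * y4 - fps_X * y3 - fps_X * y2 - fps_X * y3
          - (S * fps_X - E) * y3 - S * fps_X * y2 - S * fps_X * y2 - S * fps_X * y1
          - 3 * Q * fps_X * y2 - 3 * Q * fps_X * y1 - 3 * Q * fps_X * y1 - 3 * Q * fps_X * y0)
      - fps_X * ((1 - fps_X) * y3 - fps_X * y2 - (S * fps_X - E) * y2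
        - S * fps_X * y1 - 3 * Q * fps_X * y1 - 3 * Q * fps_X * y0)
      - (2 * S * fps_X - fps_X) * l2
      - (2 * (S * fps_X - E) - fps_X) * fps_XD l2
      + 4 * fps_X * (Q * fps_X) * y1 - 4 * (1 - fps_X) * (Q * fps_X) * y1
      - 4 * (1 - fps_X) * (Q * fps_X) * y2"
    unfolding l3 fps_XD_rules D by algebra
  \<comment> \<open>The claim is the last equation of the chain with its terms rearranged: the two differences
    agree identically as polynomials in \<open>X, S, Q, E\<close> and the \<open>y\<^sub>i\<close>.\<close>
  have "?lhs - ?rhs = (1 - fps_X) * fps_XD l3
      - ((3 * (S * fps_X - E) - 2 * fps_X) * l3 + 3 * (1 - fps_X) * (Q * fps_X) * l2)"
    unfolding Dl3 unfolding Dl2 l3 unfolding l2_def by algebra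
  also have "\<dots> = 0"
    using top unfolding fps_XD_rules by simp
  finally show ?thesis
    by simp
qed


section \<open>The four-term recurrence\<close>

text \<open>
  Comparison of the coefficients of \<open>X\<^bsup>n+1\<^esup>\<close> in \<open>hypergeometric_cube_equation\<close>. A term
  \<open>X\<^sup>i P\<^sub>i(\<theta>) y\<close> contributes \<open>P\<^sub>i(n + 1 - i) v\<^sub>n\<^sub>+\<^sub>1\<^sub>-\<^sub>i\<close>, whence the shifted arguments \<open>t - 1\<close> and
  \<open>t - 2\<close>. The polynomials for \<open>i = 0\<close> and \<open>i = 3\<close>, which carry the exponents of the equation at \<open>0\<close>
  and at infinity, factor: the former into four linear factors, the latter into two quadratics over
  \<open>s\<close> and \<open>q\<close>, which split once \<open>s = a + b\<close> and \<open>q = a b\<close>.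
\<close>

lemma cube_coefficient_recurrence:
  fixes F :: "'a :: idom fps" and s q e :: 'a
  assumes ode: "(1 - fps_X) * fps_XD (fps_XD F)
    = (fps_const s * fps_X - fps_const e) * fps_XD F + fps_const q * fps_X * F"
    and n: "n \<ge> 1"
  defines "v \<equiv> fps_nth (F ^ 3)" and "t \<equiv> of_nat n :: 'a"
  shows "(t + 1) * (t + 1 + e) * (t + 1 + 2 * e) * (t + 1 + 3 * e) * v (n + 1)
    = (3 * t^4 + (12 * e + 6 * s) * t^3
        + (11 * e^2 + 22 * s * e + 10 * q + 4 * s - 4 * e) * t^2
        + (18 * s * e^2 + 30 * q * e + 7 * s * e - 7 * e^2 + 10 * q + s - e) * t
        + 3 * q * (6 * e^2 + 5 * e + 1)) * v n
    - (3 * (t - 1)^4 + (6 * e + 12 * s) * (t - 1)^3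
        + (11 * s^2 + 22 * s * e + 20 * q + 4 * s - 4 * e) * (t - 1)^2
        + (18 * s^2 * e + 30 * s * q + 7 * s^2 + 30 * q * e - 7 * s * e + 10 * q - s + e) * (t - 1)
        + 3 * q * (12 * s * e + 3 * q + 7 * s - 2 * e - 1)) * v (n - 1)
    + ((t - 2)^2 + 3 * s * (t - 2) + 9 * q) * ((t - 2)^2 + 3 * s * (t - 2) + 2 * s^2 + q)
        * (if n \<ge> 2 then v (n - 2) else 0)"
proof -
  have t1: "of_nat (n - 1) = t - 1"
    using n by (simp add: t_def of_nat_diff)
  have t2: "of_nat (n - 2) = t - 2" if "n \<ge> 2"
    using that by (simp add: t_def of_nat_diff)
  have nth_const: "fps_nth (fps_const k * f) m = k * fps_nth f m" for k :: 'a and f m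
    by simp
  have nth_X: "fps_nth (fps_X * f) (n + 1) = fps_nth f n" for f :: "'a fps"
    by simp
  have nth_X2: "fps_nth (fps_X^2 * f) (n + 1) = fps_nth f (n - 1)" for f :: "'a fps"
    using n by (simp add: fps_X_power_mult_nth)
  have nth_X3: "fps_nth (fps_X^3 * f) (n + 1) = (if n \<ge> 2 then fps_nth f (n - 2) else 0)"
    for f :: "'a fps"
    using n unfolding fps_X_power_mult_nth by (auto intro: arg_cong[of _ _ "fps_nth f"])
  note eq = arg_cong[OF hypergeometric_cube_equation[OF ode], of "\<lambda>f. fps_nth f (n + 1)",
      unfolded fps_add_nth fps_sub_nth nth_X nth_X2 nth_X3]
  note coeffs = numeral_fps_const fps_const_1_eq_1[symmetric] fps_const_power fps_const_mult
    fps_const_add fps_const_sub mult.assoc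
  have tn: "of_nat (n + 1) = t + 1"
    by (simp add: t_def)
  show ?thesis
  proof (cases "n \<ge> 2")
    case True
    then show ?thesis
      using eq
      unfolding coeffs fps_add_nth nth_const fps_XD_nth tn t1 t2[OF True] if_P[OF True]
        v_def[symmetric] t_def[symmetric]
      by algebra
  next
    case False
    then show ?thesis
      using eq
      unfolding coeffs fps_add_nth nth_const fps_XD_nth tn t1 if_not_P[OF False]
        v_def[symmetric] t_def[symmetric]
      by algebra
  qed
qed

section \<open>Convergence in the unit disc and the cube as a power series\<close>

lemma shifted_ratio_tendsto_1:
  fixes x y :: "'a :: real_normed_field"
  assumes "\<And>k. y + of_nat k \<noteq> 0"
  shows "(\<lambda>k. (x + of_nat k) / (y + of_nat k)) \<longlonglongrightarrow> 1"
proof -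
  have "filterlim (\<lambda>k. y + of_nat k) at_infinity sequentially"
    by (intro tendsto_add_filterlim_at_infinity[OF tendsto_const] tendsto_of_nat)
  then have "(\<lambda>k. 1 + (x - y) / (y + of_nat k)) \<longlonglongrightarrow> 1 + 0"
    by (intro tendsto_add tendsto_const tendsto_divide_0[OF tendsto_const])
  moreover have "1 + (x - y) / (y + of_nat k) = (x + of_nat k) / (y + of_nat k)" for k
    using assms[of k] by (simp add: field_simps)
  ultimately show ?thesis
    by simp
qed

text \<open>
  Consecutive coefficients have a ratio tending to \<open>1\<close>. The ratio test is applied in its
  multiplicative form, so that terminating series, whose coefficients eventually vanish, are
  covered as well.
\<close>

lemma fps_hypergeo_2_1_conv_radius:
  fixes a b c :: "'a :: {real_normed_field, banach}"
  assumes c: "\<And>k. c + of_nat k \<noteq> 0"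
  shows "fps_conv_radius (fps_hypergeo [a, b] [c] 1) \<ge> 1"
  unfolding fps_conv_radius_def
proof (rule conv_radius_geI_ex')
  fix r :: real
  assume r: "0 < r" "ereal r < 1"
  let ?f = "\<lambda>k. fps_nth (fps_hypergeo [a, b] [c] 1) k * of_real r ^ k"
  let ?R = "\<lambda>k. (a + of_nat k) * (b + of_nat k) / ((1 + of_nat k) * (c + of_nat k)) * of_real r"
  have one: "(1 :: 'a) + of_nat k \<noteq> 0" for k
    using of_nat_neq_0[of k] by simp
  have "(\<lambda>k. (a + of_nat k) / (1 + of_nat k) * ((b + of_nat k) / (c + of_nat k)) * of_real r)
      \<longlonglongrightarrow> 1 * 1 * of_real r"
    using one c by (intro tendsto_mult tendsto_const shifted_ratio_tendsto_1)
  then have "?R \<longlonglongrightarrow> of_real r"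
    by simp
  then have "(\<lambda>k. norm (?R k)) \<longlonglongrightarrow> r"
    using r tendsto_norm by fastforce
  \<comment> \<open>Any constant strictly between \<open>r\<close> and \<open>1\<close> serves as the ratio; the midpoint is one.\<close>
  then have "eventually (\<lambda>k. norm (?R k) < (1 + r) / 2) sequentially"
    using r by (intro order_tendstoD) auto
  then obtain N where N: "\<And>k. k \<ge> N \<Longrightarrow> norm (?R k) < (1 + r) / 2"
    by (auto simp: eventually_sequentially)
  show "summable ?f"
  proof (rule summable_ratio_test)
    show "(1 + r) / 2 < 1" using r by simp
    fix k assume "k \<ge> N"
    have "?f (Suc k) = ?R k * ?f k"
      unfolding fps_hypergeo_2_1_nth_Suc by (simp only: power_Suc mult_ac)
    then have "norm (?f (Suc k)) = norm (?R k) * norm (?f k)"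
      by (simp only: norm_mult)
    also have "\<dots> \<le> (1 + r) / 2 * norm (?f k)"
      using N[OF \<open>k \<ge> N\<close>] by (intro mult_right_mono) auto
    finally show "norm (?f (Suc k)) \<le> (1 + r) / 2 * norm (?f k)" .
  qed
qed

theorem theorem3p1:
  fixes a b c :: complex
  assumes "- c \<notin> \<nat>"
  shows "\<exists>v :: nat \<Rightarrow> complex.
    v 0 = 1 \<and>
    v 1 = 3*a*b / c \<and>
    v 2 = 3*a^2*b^2 / c^2 + 3*a*(a + 1)*(b + 1)*b / (2*c*(c + 1)) \<and>
    cube_recurrence a b c v \<and>
    (\<forall>z. norm z < 1 \<longrightarrow> (\<lambda>n. v n * z ^ n) sums (hyp2F1 a b c z) ^ 3)"
proof -
  define F where "F = fps_hypergeo [a, b] [c] 1"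
  have c: "c + of_nat k \<noteq> 0" for k
    using assms by (metis add.inverse_unique add.commute of_nat_in_Nats)
  define v where "v = fps_nth (F ^ 3)"
  have F0: "fps_nth F 0 = 1" and F1: "fps_nth F 1 = a * b / c"
    and F2: "fps_nth F 2 = a * (a + 1) * (b * (b + 1)) / (c * (c + 1) * 2)"
    by (simp_all add: F_def numeral_2_eq_2 pochhammer_Suc)
  have v0: "v 0 = 1"
    by (simp add: v_def F0 power3_eq_cube)
  have v1: "v 1 = 3*a*b / c"
    using F0 F1 by (simp add: v_def power3_eq_cube fps_mult_nth)
  have "v 2 = 3 * (fps_nth F 1)^2 + 3 * fps_nth F 2"
    using F0 by (simp add: v_def power3_eq_cube fps_mult_nth numeral_2_eq_2 algebra_simps)
  then have v2: "v 2 = 3*a^2*b^2 / c^2 + 3*a*(a + 1)*(b + 1)*b / (2*c*(c + 1))"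
    unfolding F1 F2 by (simp add: power2_eq_square algebra_simps)
  have rec: "cube_recurrence a b c v"
    unfolding cube_recurrence_def
  proof (intro allI impI)
    fix n :: nat
    assume n: "1 \<le> n" and D: "D_cube c (of_nat n) \<noteq> 0"
    define t where "t = (of_nat n :: complex)"
    define u where "u = (if 2 \<le> n then v (n - 2) else 0)"
    have ode: "(1 - fps_X) * fps_XD (fps_XD F)
        = (fps_const (a + b) * fps_X - fps_const (c - 1)) * fps_XD F
          + fps_const (a * b) * fps_X * F"
      unfolding F_def by (rule fps_hypergeo_2_1_equation[OF c])
    have t: "D_cube c t \<noteq> 0"
      using D by (simp add: t_def)
    \<comment> \<open>Cleared of denominators, the coefficients are polynomials in \<open>a, b, c, t\<close>, and those of
      \<open>cube_coefficient_recurrence\<close> become the same ones for \<open>s = a + b\<close>, \<open>q = a b\<close>, \<open>e = c - 1\<close>.\<close>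
    have D0: "D_cube c t * beta0 a b c t = (3*t^4 + 6*(a + b + 2*c - 2)*t^3
      + (2*a*(5*b + 11*c - 9) + 11*c*(2*b + c) - 18*b - 26*c + 15)*t^2
      + (c^2*(18*a + 18*b - 7) + c*(a*(30*b - 29) - 29*b + 13) + 4*a*(3 - 5*b) + 12*b - 6)*t
      + 3*a*b*(c*(6*c - 7) + 2))"
      using t by (simp add: beta0_def)
    have D1: "D_cube c t * beta1 a b c t = - (3*t^4 + 6*(2*a + 2*b + c - 3)*t^3
      + (11*a^2 + 42*a*b + 22*a*c - 54*a + 11*b^2 + 22*b*c - 54*b - 22*c + 40)*t^2
      + 3*(10*a^2*b + 6*a^2*c - 11*a^2 + 10*a*b^2 + 22*a*b*c - 42*a*b - 17*a*c + 26*a)*t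
      + 3*(6*b^2*c - 11*b^2 - 17*b*c + 26*b + 9*c - 13)*t
      + 9*a^2*b^2 + 36*a^2*b*c - 45*a^2*b - 18*a^2*c + 22*a^2 + 36*a*b^2*c - 45*a*b^2 - 72*a*b*c
      + 87*a*b + 29*a*c - 36*a - 18*b^2*c + 22*b^2 + 29*b*c - 36*b - 11*c + 14)"
      using t by (simp add: beta1_def)
    have D2: "D_cube c t * beta2 a b c t = (3*a + t - 2) * (3*b + t - 2) * (2*a + b + t - 2)
      * (a + 2*b + t - 2)"
      using t by (simp add: beta2_def)
    have "D_cube c t * v (n + 1) = D_cube c t * beta0 a b c t * v n
        + D_cube c t * beta1 a b c t * v (n - 1) + D_cube c t * beta2 a b c t * u"
      unfolding D0 D1 D2 unfolding D_cube_def
      using cube_coefficient_recurrence[OF ode n, folded v_def t_def, folded u_def]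
      by algebra
    then have "D_cube c t * v (n + 1)
        = D_cube c t * (beta0 a b c t * v n + beta1 a b c t * v (n - 1) + beta2 a b c t * u)"
      by (simp add: ring_distribs mult.assoc)
    then show "v (n + 1) = beta0 a b c (of_nat n) * v n + beta1 a b c (of_nat n) * v (n - 1)
        + beta2 a b c (of_nat n) * (if 2 \<le> n then v (n - 2) else 0)"
      using D unfolding t_def u_def by simp
  qed
  have "(\<lambda>n. v n * z ^ n) sums (hyp2F1 a b c z) ^ 3" if "norm z < 1" for z
  proof -
    have "ereal (norm z) < 1"
      using that by simp
    then have z: "ereal (norm z) < fps_conv_radius F"
      unfolding F_def using fps_hypergeo_2_1_conv_radius[OF c] by (rule less_le_trans)
    then have "ereal (norm z) < fps_conv_radius (F ^ 3)"
      using fps_conv_radius_power[of F 3] by (rule less_le_trans)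
    from sums_eval_fps[OF this] show ?thesis
      unfolding v_def hyp2F1_eq_eval_fps F_def[symmetric] eval_fps_power[OF z] .
  qed
  with v0 v1 v2 rec show ?thesis by blast
qed

end
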